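(* Let $(H^*,H_*,\kappa,c)$ be a Tamarkin–Tsygan calculus with duality over the field $k$, with fundamental class $c\in H_d$. Let $D=(c\cap -)^{-1}$ denote the inverse of the duality isomorphism, so $D:H_{d-p}\to H^p$ for every integer $p$. Then the Gerstenhaber algebra $H^*$ is a BV-algebra; more precisely, $\Delta:=(-1)^d\,D\,\kappa\,D^{-1}:H^*\to H^{*-1}$ is a generator of the Gerstenhaber bracket of $H^*$, i.e. for all $\alpha\in H^p$ and $\beta\in H^q$, $$[\alpha,\beta]=\Delta(\alpha\cup\beta)-(-1)^p\,\alpha\cup\Delta(\beta)-\Delta(\alpha)\cup\beta .$$
   Context: $k$ is a field. **Gerstenhaber algebra.** Let $H^*=\bigoplus_{p\ge 0}H^p$ be a graded $k$-vector space (with $H^p=0$ for $p<0$). For $\alpha\in H^p$ put $|\alpha|=p$ and $\deg(\alpha)=p-1$; let $\mathcal L^*$ be the shifted space $\mathcal L^p=H^{p+1}$. $H^*$ is a Gerstenhaber algebra if it carries operations $\cup$ (of degree $0$ on $H^*$) and $[\ ,\ ]$ (of degree $0$ on $\mathcal L^*$, i.e. $[H^p,H^q]\subset H^{p+q-1}$) such that: (1) $(H^*,\cup)$ is a (unital associative) graded commutative algebra: $\alpha\cup\beta=(-1)^{|\alpha||\beta|}\beta\cup\alpha$; (2) $(\mathcal L^*,[\ ,\ ])$ is a graded Lie algebra: $[\alpha,\beta]=-(-1)^{\deg(\alpha)\deg(\beta)}[\beta,\alpha]$ and $(-1)^{\deg(\alpha)\deg(\gamma)}[\alpha,[\beta,\gamma]]+(-1)^{\deg(\beta)\deg(\alpha)}[\beta,[\gamma,\alpha]]+(-1)^{\deg(\gamma)\deg(\beta)}[\gamma,[\alpha,\beta]]=0$;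 (3) $[\alpha,\beta\cup\gamma]=[\alpha,\beta]\cup\gamma+(-1)^{\deg(\alpha)|\beta|}\beta\cup[\alpha,\gamma]$. **Tamarkin–Tsygan calculus.** A triple $(H^*,H_*,\kappa)$, with $H^*,H_*$ graded $k$-vector spaces, such that: (a) $(H^*,\cup,[\ ,\ ])$ is a Gerstenhaber algebra with $k\subset H^0$; (b) $H_*$ is a graded $(H^*,\cup)$-module: there are $k$-linear maps $H^p\otimes_k H_r\to H_{r-p}$, $\alpha\otimes z\mapsto z\cap\alpha$, such that, putting $\iota_\alpha(z)=(-1)^{rp}\,z\cap\alpha$ for $z\in H_r$, $\alpha\in H^p$, one has $\iota_\alpha\circ\iota_\beta=\iota_{\alpha\cup\beta}$; (c) there is a $k$-linear map $\kappa:H_*\to H_{*+1}$ with $\kappa^2=0$ such that, putting $L_\alpha=[\kappa,\iota_\alpha]_{gr}=\kappa\,\iota_\alpha-(-1)^{|\alpha|}\iota_\alpha\,\kappa$, one has $[L_\alpha,\iota_\beta]_{gr}=\iota_{[\alpha,\beta]}$, where $[L_\alpha,\iota_\beta]_{gr}=L_\alpha\iota_\beta-(-1)^{(|\alpha|-1)|\beta|}\iota_\beta L_\alpha$. **With duality.** The calculus is with duality if there is $c\in H_d$ such that $c\cap 1=c$ and, for every integer $p$, the map $c\cap -:H^p\to H_{d-p}$ is an isomorphism. This map is the duality isomorphism and $c$ is the fundamental class. **BV-algebra.** A Gerstenhaber algebra $H^*$ is a BV-algebra (Batalin–Vilkovisky algebra) if there is a $k$-linear map $\Delta:H^*\to H^{*-1}$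 with $\Delta^2=0$ that is a generator of the bracket, i.e. satisfies the displayed relation of the claim. *)

theory Defs
  imports Complex_Main
begin

text \<open>
  A graded vector space is an internal direct sum: the type carries the whole space and
  \<open>G n\<close> is the subspace of homogeneous elements of degree \<open>n\<close>.  Both cohomological
  and homological degrees are integers.
\<close>

definition decomposition :: "(int \<Rightarrow> 'v::ab_group_add set) \<Rightarrow> 'v \<Rightarrow> (int \<Rightarrow> 'v) \<Rightarrow> bool" where
  "decomposition G x f \<longleftrightarrow>
     (\<forall>n. f n \<in> G n) \<and> finite {n. f n \<noteq> 0} \<and> x = (\<Sum>n | f n \<noteq> 0. f n)"

locale graded_vector_space = vector_space scale
  for scale :: "'k::field \<Rightarrow> 'v::ab_group_add \<Rightarrow> 'v" +
  fixes G :: "int \<Rightarrow> 'v set"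
  assumes subspace_G: "subspace (G n)"
    and direct_sum: "\<exists>!f. decomposition G x f"

definition component :: "(int \<Rightarrow> 'v::ab_group_add set) \<Rightarrow> 'v \<Rightarrow> int \<Rightarrow> 'v" where
  "component G x = (THE f. decomposition G x f)"

locale gerstenhaber_algebra = graded_vector_space scale H
  for scale :: "'k::field \<Rightarrow> 'a::ab_group_add \<Rightarrow> 'a"
    and H :: "int \<Rightarrow> 'a set" +
  fixes cup :: "'a \<Rightarrow> 'a \<Rightarrow> 'a"  (infixl "\<squnion>" 70)
    and one :: 'a
    and bracket :: "'a \<Rightarrow> 'a \<Rightarrow> 'a"
  assumes H_negative: "p < 0 \<Longrightarrow> H p = {0}"
    and cup_linear_right: "Vector_Spaces.linear scale scale (\<lambda>\<beta>. \<alpha> \<squnion> \<beta>)"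
    and cup_linear_left: "Vector_Spaces.linear scale scale (\<lambda>\<alpha>. \<alpha> \<squnion> \<beta>)"
    and cup_degree: "\<lbrakk>\<alpha> \<in> H p; \<beta> \<in> H q\<rbrakk> \<Longrightarrow> \<alpha> \<squnion> \<beta> \<in> H (p + q)"
    and cup_assoc: "(\<alpha> \<squnion> \<beta>) \<squnion> \<gamma> = \<alpha> \<squnion> (\<beta> \<squnion> \<gamma>)"
    and one_degree: "one \<in> H 0"
    and cup_one_left: "one \<squnion> \<alpha> = \<alpha>"
    and cup_one_right: "\<alpha> \<squnion> one = \<alpha>"
    and cup_commute: "\<lbrakk>\<alpha> \<in> H p; \<beta> \<in> H q\<rbrakk> \<Longrightarrow>
      \<alpha> \<squnion> \<beta> = scale ((-1) powi (p * q)) (\<beta> \<squnion> \<alpha>)"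
    and bracket_linear_right: "Vector_Spaces.linear scale scale (\<lambda>\<beta>. bracket \<alpha> \<beta>)"
    and bracket_linear_left: "Vector_Spaces.linear scale scale (\<lambda>\<alpha>. bracket \<alpha> \<beta>)"
    and bracket_degree: "\<lbrakk>\<alpha> \<in> H p; \<beta> \<in> H q\<rbrakk> \<Longrightarrow> bracket \<alpha> \<beta> \<in> H (p + q - 1)"
    and bracket_antisym: "\<lbrakk>\<alpha> \<in> H p; \<beta> \<in> H q\<rbrakk> \<Longrightarrow>
      bracket \<alpha> \<beta> = - scale ((-1) powi ((p - 1) * (q - 1))) (bracket \<beta> \<alpha>)"
    and bracket_jacobi: "\<lbrakk>\<alpha> \<in> H p; \<beta> \<in> H q; \<gamma> \<in> H r\<rbrakk> \<Longrightarrow>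
        scale ((-1) powi ((p - 1) * (r - 1))) (bracket \<alpha> (bracket \<beta> \<gamma>))
      + scale ((-1) powi ((q - 1) * (p - 1))) (bracket \<beta> (bracket \<gamma> \<alpha>))
      + scale ((-1) powi ((r - 1) * (q - 1))) (bracket \<gamma> (bracket \<alpha> \<beta>)) = 0"
    and bracket_leibniz: "\<lbrakk>\<alpha> \<in> H p; \<beta> \<in> H q; \<gamma> \<in> H r\<rbrakk> \<Longrightarrow>
      bracket \<alpha> (\<beta> \<squnion> \<gamma>) =
        bracket \<alpha> \<beta> \<squnion> \<gamma> + scale ((-1) powi ((p - 1) * q)) (\<beta> \<squnion> bracket \<alpha> \<gamma>)"

locale BV_generator = gerstenhaber_algebra scale H cup one bracket
  for scale :: "'k::field \<Rightarrow> 'a::ab_group_add \<Rightarrow> 'a"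
    and H :: "int \<Rightarrow> 'a set"
    and cup :: "'a \<Rightarrow> 'a \<Rightarrow> 'a"  (infixl "\<squnion>" 70)
    and one :: 'a
    and bracket :: "'a \<Rightarrow> 'a \<Rightarrow> 'a" +
  fixes \<Delta> :: "'a \<Rightarrow> 'a"
  assumes \<Delta>_linear: "Vector_Spaces.linear scale scale \<Delta>"
    and \<Delta>_degree: "\<alpha> \<in> H p \<Longrightarrow> \<Delta> \<alpha> \<in> H (p - 1)"
    and \<Delta>_square: "\<Delta> (\<Delta> \<alpha>) = 0"
    and \<Delta>_generates: "\<lbrakk>\<alpha> \<in> H p; \<beta> \<in> H q\<rbrakk> \<Longrightarrow>
      bracket \<alpha> \<beta> = \<Delta> (\<alpha> \<squnion> \<beta>) - scale ((-1) powi p) (\<alpha> \<squnion> \<Delta> \<beta>) - \<Delta> \<alpha> \<squnion> \<beta>"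

definition BV_algebra ::
  "('k::field \<Rightarrow> 'a::ab_group_add \<Rightarrow> 'a) \<Rightarrow> (int \<Rightarrow> 'a set) \<Rightarrow> ('a \<Rightarrow> 'a \<Rightarrow> 'a) \<Rightarrow> 'a
    \<Rightarrow> ('a \<Rightarrow> 'a \<Rightarrow> 'a) \<Rightarrow> bool" where
  "BV_algebra scale H cup one bracket \<longleftrightarrow> (\<exists>\<Delta>. BV_generator scale H cup one bracket \<Delta>)"

text \<open>
  \<open>contraction \<alpha> z\<close> is the operator \<open>\<iota>\<^sub>\<alpha>(z) = (-1)\<^sup>r\<^sup>p z \<inter> \<alpha>\<close>, given by this formula for
  homogeneous \<open>z\<close> of degree \<open>r\<close> and \<open>\<alpha>\<close> of degree \<open>p\<close>, and extended bilinearly so that it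
  acts on the whole of the homology.
\<close>

locale cap_product =
  coh: gerstenhaber_algebra scale H cup one bracket + hom: graded_vector_space scale' Hl
  for scale :: "'k::field \<Rightarrow> 'a::ab_group_add \<Rightarrow> 'a"
    and H :: "int \<Rightarrow> 'a set"
    and cup :: "'a \<Rightarrow> 'a \<Rightarrow> 'a"  (infixl "\<squnion>" 70)
    and one :: 'a
    and bracket :: "'a \<Rightarrow> 'a \<Rightarrow> 'a"
    and scale' :: "'k \<Rightarrow> 'b::ab_group_add \<Rightarrow> 'b"
    and Hl :: "int \<Rightarrow> 'b set" +
  fixes cap :: "'b \<Rightarrow> 'a \<Rightarrow> 'b"  (infixl "\<sqinter>" 70)
  assumes cap_linear_right: "Vector_Spaces.linear scale scale' (\<lambda>\<alpha>. z \<sqinter> \<alpha>)"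
    and cap_linear_left: "Vector_Spaces.linear scale' scale' (\<lambda>z. z \<sqinter> \<alpha>)"
    and cap_degree: "\<lbrakk>z \<in> Hl r; \<alpha> \<in> H p\<rbrakk> \<Longrightarrow> z \<sqinter> \<alpha> \<in> Hl (r - p)"
begin

definition contraction :: "'a \<Rightarrow> 'b \<Rightarrow> 'b" where
  "contraction \<alpha> z =
     (\<Sum>p | component H \<alpha> p \<noteq> 0. \<Sum>r | component Hl z r \<noteq> 0.
        scale' ((-1) powi (r * p)) (component Hl z r \<sqinter> component H \<alpha> p))"

end

locale graded_module = cap_product scale H cup one bracket scale' Hl cap
  for scale :: "'k::field \<Rightarrow> 'a::ab_group_add \<Rightarrow> 'a"
    and H :: "int \<Rightarrow> 'a set"
    and cup :: "'a \<Rightarrow> 'a \<Rightarrow> 'a"  (infixl "\<squnion>" 70)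
    and one :: 'a
    and bracket :: "'a \<Rightarrow> 'a \<Rightarrow> 'a"
    and scale' :: "'k \<Rightarrow> 'b::ab_group_add \<Rightarrow> 'b"
    and Hl :: "int \<Rightarrow> 'b set"
    and cap :: "'b \<Rightarrow> 'a \<Rightarrow> 'b"  (infixl "\<sqinter>" 70) +
  assumes contraction_cup: "\<lbrakk>\<alpha> \<in> H p; \<beta> \<in> H q\<rbrakk> \<Longrightarrow>
    contraction \<alpha> \<circ> contraction \<beta> = contraction (\<alpha> \<squnion> \<beta>)"

locale connes_operator = graded_module scale H cup one bracket scale' Hl cap
  for scale :: "'k::field \<Rightarrow> 'a::ab_group_add \<Rightarrow> 'a"
    and H :: "int \<Rightarrow> 'a set"
    and cup :: "'a \<Rightarrow> 'a \<Rightarrow> 'a"  (infixl "\<squnion>" 70)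
    and one :: 'a
    and bracket :: "'a \<Rightarrow> 'a \<Rightarrow> 'a"
    and scale' :: "'k \<Rightarrow> 'b::ab_group_add \<Rightarrow> 'b"
    and Hl :: "int \<Rightarrow> 'b set"
    and cap :: "'b \<Rightarrow> 'a \<Rightarrow> 'b"  (infixl "\<sqinter>" 70) +
  fixes \<kappa> :: "'b \<Rightarrow> 'b"
  assumes \<kappa>_linear: "Vector_Spaces.linear scale' scale' \<kappa>"
    and \<kappa>_degree: "z \<in> Hl r \<Longrightarrow> \<kappa> z \<in> Hl (r + 1)"
    and \<kappa>_square: "\<kappa> (\<kappa> z) = 0"
begin

text \<open>
  For \<open>\<alpha>\<close> of degree \<open>p\<close>; the degree is a separate argument because it enters the sign of the
  graded commutator of \<open>\<kappa>\<close> and \<open>\<iota>\<^sub>\<alpha>\<close>.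
\<close>

definition lie_derivative :: "int \<Rightarrow> 'a \<Rightarrow> 'b \<Rightarrow> 'b" where
  "lie_derivative p \<alpha> z =
     \<kappa> (contraction \<alpha> z) - scale' ((-1) powi p) (contraction \<alpha> (\<kappa> z))"

end

locale tamarkin_tsygan_calculus = connes_operator scale H cup one bracket scale' Hl cap \<kappa>
  for scale :: "'k::field \<Rightarrow> 'a::ab_group_add \<Rightarrow> 'a"
    and H :: "int \<Rightarrow> 'a set"
    and cup :: "'a \<Rightarrow> 'a \<Rightarrow> 'a"  (infixl "\<squnion>" 70)
    and one :: 'a
    and bracket :: "'a \<Rightarrow> 'a \<Rightarrow> 'a"
    and scale' :: "'k \<Rightarrow> 'b::ab_group_add \<Rightarrow> 'b"
    and Hl :: "int \<Rightarrow> 'b set"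
    and cap :: "'b \<Rightarrow> 'a \<Rightarrow> 'b"  (infixl "\<sqinter>" 70)
    and \<kappa> :: "'b \<Rightarrow> 'b" +
  assumes field_embeds: "inj (\<lambda>a. scale a one)"
    and lie_contraction: "\<lbrakk>\<alpha> \<in> H p; \<beta> \<in> H q\<rbrakk> \<Longrightarrow>
      lie_derivative p \<alpha> (contraction \<beta> z)
        - scale' ((-1) powi ((p - 1) * q)) (contraction \<beta> (lie_derivative p \<alpha> z))
      = contraction (bracket \<alpha> \<beta>) z"

text \<open>
  A bijective \<open>cap c\<close> on each \<open>H p\<close> is an isomorphism, since it is linear by
  \<open>cap_linear_right\<close>.  As both spaces are the direct sums of their homogeneous parts,
  \<open>cap c\<close> is then a bijection of the whole spaces, and \<open>inv (cap c)\<close> is its genuine inverse.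
\<close>

locale calculus_with_duality = tamarkin_tsygan_calculus scale H cup one bracket scale' Hl cap \<kappa>
  for scale :: "'k::field \<Rightarrow> 'a::ab_group_add \<Rightarrow> 'a"
    and H :: "int \<Rightarrow> 'a set"
    and cup :: "'a \<Rightarrow> 'a \<Rightarrow> 'a"  (infixl "\<squnion>" 70)
    and one :: 'a
    and bracket :: "'a \<Rightarrow> 'a \<Rightarrow> 'a"
    and scale' :: "'k \<Rightarrow> 'b::ab_group_add \<Rightarrow> 'b"
    and Hl :: "int \<Rightarrow> 'b set"
    and cap :: "'b \<Rightarrow> 'a \<Rightarrow> 'b"  (infixl "\<sqinter>" 70)
    and \<kappa> :: "'b \<Rightarrow> 'b" +
  fixes d :: int and c :: 'b
  assumes c_degree: "c \<in> Hl d"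
    and c_one: "c \<sqinter> one = c"
    and duality: "bij_betw (cap c) (H p) (Hl (d - p))"

end

theory Submission
  imports Defs
begin

text \<open>
  The idea is that evaluating contractions at the fundamental class \<open>c\<close> loses nothing:
  on \<open>H p\<close> the map \<open>\<gamma> \<mapsto> \<iota>\<^sub>\<gamma> c\<close> is the duality isomorphism up to the sign \<open>(-1)\<^bsup>dp\<^esup>\<close>,
  hence injective.  The sign \<open>(-1)\<^sup>d\<close> in the definition of \<open>\<Delta>\<close> is the one that makes
  \<open>\<kappa> (\<iota>\<^sub>\<gamma> c) = \<iota>\<^bsub>\<Delta> \<gamma>\<^esub> c\<close> hold for every homogeneous \<open>\<gamma>\<close>
  (\<open>connes_contraction_fundamental\<close>).  Moreover \<open>\<kappa> c = 0\<close>, because \<open>\<kappa> c\<close> has degree \<open>d + 1\<close> and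
  so corresponds to a class in \<open>H (-1) = 0\<close> (\<open>connes_fundamental_class\<close>).

  Writing out both graded commutators in the axiom \<open>[[\<kappa>, \<iota>\<^sub>\<alpha>], \<iota>\<^sub>\<beta>] = \<iota>\<^bsub>[\<alpha>,\<beta>]\<^esub>\<close> gives four terms:
  \[ \iota_{[\alpha,\beta]} = \kappa\iota_\alpha\iota_\beta - (-1)^p \iota_\alpha\kappa\iota_\beta
      - (-1)^{(p-1)q} \iota_\beta\kappa\iota_\alpha + (-1)^{(p-1)q+p} \iota_\beta\iota_\alpha\kappa . \]
  At \<open>c\<close> the last one vanishes, and moving \<open>\<kappa>\<close> inside the contractions turns the others into
  the contractions of \<open>c\<close> by \<open>\<Delta> (\<alpha> \<squnion> \<beta>)\<close>, by \<open>\<alpha> \<squnion> \<Delta> \<beta>\<close> and by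
  \<open>\<beta> \<squnion> \<Delta> \<alpha>\<close>.  Graded commutativity absorbs the sign of the third, and injectivity of
  \<open>\<gamma> \<mapsto> \<iota>\<^sub>\<gamma> c\<close> gives the relation in \<open>H\<close> (\<open>bracket_generated\<close>).
\<close>

section \<open>Graded vector spaces\<close>

context graded_vector_space
begin

lemma component_eqI: "decomposition G x f \<Longrightarrow> component G x = f"
  unfolding component_def using direct_sum[of x] by (blast intro: the1_equality)

lemma decomposition_component: "decomposition G x (component G x)"
  unfolding component_def by (rule theI'[OF direct_sum])

lemma component_homogeneous:
  assumes "x \<in> G p"
  shows "component G x = (\<lambda>n. if n = p then x else 0)"
proof (rule component_eqI)
  have "{n. (if n = p then x else 0) \<noteq> 0} = (if x = 0 then {} else {p})"
    by auto
  then show "decomposition G x (\<lambda>n. if n = p then x else 0)"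
    unfolding decomposition_def using assms subspace_G by (auto simp: subspace_0)
qed

end

text \<open>
  The substitution \<open>n \<mapsto> d - n\<close> permutes the degrees, so \<open>f\<close> carries the decomposition of \<open>x\<close> to
  a decomposition of \<open>f x\<close>, and uniqueness there lets injectivity be tested degree by degree.
\<close>
lemma bij_if_bij_on_homogeneous_parts:
  fixes f :: "'a::ab_group_add \<Rightarrow> 'b::ab_group_add" and d :: int
  assumes G: "graded_vector_space s G" and G': "graded_vector_space s' G'"
    and lin: "Vector_Spaces.linear s s' f"
    and bij: "\<And>n. bij_betw f (G n) (G' (d - n))"
  shows "bij f"
proof -
  interpret A: graded_vector_space s G by (rule G)
  interpret B: graded_vector_space s' G' by (rule G')
  interpret f: Vector_Spaces.linear s s' f by (rule lin)
  have "inj f"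
    unfolding f.inj_iff_eq_0
  proof (intro allI impI)
    fix x assume fx: "f x = 0"
    let ?x = "component G x"
    let ?S = "{n. ?x n \<noteq> 0}"
    let ?g = "\<lambda>m. f (?x (d - m))"
    have x: "\<And>n. ?x n \<in> G n" "finite ?S" "x = (\<Sum>n\<in>?S. ?x n)"
      using A.decomposition_component[of x] unfolding decomposition_def by blast+
    have f_in: "f (?x n) \<in> G' (d - n)" for n
      by (rule bij_betwE[OF bij, rule_format, OF x(1)])
    have f_eq_0: "f (?x n) = 0 \<longleftrightarrow> ?x n = 0" for n
      using inj_on_eq_iff[OF bij_betw_imp_inj_on[OF bij[of n]] x(1)[of n]
          A.subspace_0[OF A.subspace_G]]
      by (simp only: f.zero)
    have supp: "{m. ?g m \<noteq> 0} = (\<lambda>n. d - n) ` ?S"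
    proof (intro equalityI subsetI)
      fix m assume "m \<in> {m. ?g m \<noteq> 0}"
      then show "m \<in> (\<lambda>n. d - n) ` ?S"
        by (intro image_eqI[of _ _ "d - m"]) (auto simp: f_eq_0)
    qed (auto simp: f_eq_0)
    have "decomposition G' (f x) ?g"
      unfolding decomposition_def
    proof (intro conjI allI)
      show "?g m \<in> G' m" for m using f_in[of "d - m"] by simp
      show "finite {m. ?g m \<noteq> 0}" unfolding supp using x(2) by simp
      have "f x = (\<Sum>n\<in>?S. f (?x n))" by (subst x(3)) (rule f.sum)
      also have "\<dots> = sum ?g ((\<lambda>n. d - n) ` ?S)"
        by (subst sum.reindex) (auto simp: inj_on_def)
      finally show "f x = sum ?g {m. ?g m \<noteq> 0}" unfolding supp .
    qed
    then have "?g = (\<lambda>n. if n = 0 then 0 else 0)"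
      using B.component_eqI[of "f x" ?g] B.component_homogeneous[of 0 0]
        B.subspace_0[OF B.subspace_G] fx by simp
    then have "?g (d - n) = 0" for n by (auto dest: fun_cong[of _ _ "d - n"])
    then have "?x n = 0" for n using f_eq_0[of n] by simp
    then show "x = 0" by (subst x(3)) simp
  qed
  moreover have "surj f"
  proof (rule surjI)
    fix y
    let ?y = "component G' y"
    let ?S = "{n. ?y n \<noteq> 0}"
    have y: "\<And>n. ?y n \<in> G' n" "y = (\<Sum>n\<in>?S. ?y n)"
      using B.decomposition_component[of y] unfolding decomposition_def by blast+
    have "\<exists>u. f u = ?y n" for n
    proof -
      have "?y n \<in> f ` G (d - n)"
        using bij[of "d - n"] y(1)[of n] by (simp add: bij_betw_def)
      then show ?thesis by (metis imageE)
    qed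
    then obtain u where u: "\<And>n. f (u n) = ?y n" by metis
    have "f (\<Sum>n\<in>?S. u n) = (\<Sum>n\<in>?S. ?y n)" by (simp only: f.sum u)
    also note y(2)[symmetric]
    finally have "f (\<Sum>n\<in>?S. u n) = y" .
    then show "f (SOME x. f x = y) = y" by (rule someI)
  qed
  ultimately show ?thesis by (rule bijI)
qed

section \<open>Contraction by homogeneous classes\<close>

context cap_product
begin

lemma contraction_homogeneous:
  assumes "\<alpha> \<in> H p" "z \<in> Hl r"
  shows "contraction \<alpha> z = scale' ((-1) powi (r * p)) (z \<sqinter> \<alpha>)"
proof -
  interpret R: Vector_Spaces.linear scale scale' "\<lambda>\<alpha>. z \<sqinter> \<alpha>" by (rule cap_linear_right)
  interpret L: Vector_Spaces.linear scale' scale' "\<lambda>z. z \<sqinter> \<alpha>" by (rule cap_linear_left)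
  have "{n. (if n = p then \<alpha> else 0) \<noteq> 0} = (if \<alpha> = 0 then {} else {p})"
    and "{n. (if n = r then z else 0) \<noteq> 0} = (if z = 0 then {} else {r})"
    by auto
  then show ?thesis
    unfolding contraction_def coh.component_homogeneous[OF assms(1)]
      hom.component_homogeneous[OF assms(2)]
    using R.zero L.zero by auto
qed

lemma contraction_zero_right: "contraction \<alpha> 0 = 0"
proof -
  have "component Hl 0 = (\<lambda>_. 0)"
    using hom.component_homogeneous[of 0 0] hom.subspace_0[OF hom.subspace_G] by auto
  then show ?thesis by (simp add: contraction_def)
qed

lemma contraction_diff_left:
  assumes "\<alpha> \<in> H p" "\<beta> \<in> H p" "z \<in> Hl r"
  shows "contraction (\<alpha> - \<beta>) z = contraction \<alpha> z - contraction \<beta> z"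
proof -
  interpret R: Vector_Spaces.linear scale scale' "\<lambda>\<alpha>. z \<sqinter> \<alpha>" by (rule cap_linear_right)
  have "\<alpha> - \<beta> \<in> H p" by (rule coh.subspace_diff[OF coh.subspace_G assms(1,2)])
  then show ?thesis
    using assms by (simp add: contraction_homogeneous R.diff hom.scale_right_diff_distrib)
qed

lemma contraction_scale_left:
  assumes "\<alpha> \<in> H p" "z \<in> Hl r"
  shows "contraction (scale a \<alpha>) z = scale' a (contraction \<alpha> z)"
proof -
  interpret R: Vector_Spaces.linear scale scale' "\<lambda>\<alpha>. z \<sqinter> \<alpha>" by (rule cap_linear_right)
  have "scale a \<alpha> \<in> H p" by (rule coh.subspace_scale[OF coh.subspace_G assms(1)])
  then show ?thesis
    using assms by (simp add: contraction_homogeneous R.scale mult.commute)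
qed

end

section \<open>The operator transported from homology by duality\<close>

context calculus_with_duality
begin

definition dual_connes :: "'a \<Rightarrow> 'a" where
  "dual_connes \<alpha> = scale ((-1) powi d) (inv (cap c) (\<kappa> (c \<sqinter> \<alpha>)))"

lemma bij_cap_fundamental: "bij (cap c)"
  using bij_if_bij_on_homogeneous_parts[OF coh.graded_vector_space_axioms
      hom.graded_vector_space_axioms cap_linear_right duality] .

lemma cap_inv_cap: "c \<sqinter> inv (cap c) z = z"
  using bij_cap_fundamental by (simp add: bij_is_surj surj_f_inv_f)

lemma inv_cap_degree: "bij_betw (inv (cap c)) (Hl (d - p)) (H p)"
proof -
  have "inv (cap c) z = inv_into (H p) (cap c) z" if "z \<in> Hl (d - p)" for z
    using bij_betw_inv_into_right[OF duality that] bij_is_inj[OF bij_cap_fundamental]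
    by (rule inv_f_eq[rotated])
  then show ?thesis
    using bij_betw_inv_into[OF duality[of p]] by (simp cong: bij_betw_cong)
qed

lemma cap_dual_connes: "c \<sqinter> dual_connes \<alpha> = scale' ((-1) powi d) (\<kappa> (c \<sqinter> \<alpha>))"
proof -
  interpret R: Vector_Spaces.linear scale scale' "cap c" by (rule cap_linear_right)
  show ?thesis by (simp add: dual_connes_def R.scale cap_inv_cap)
qed

lemma dual_connes_degree:
  assumes "\<alpha> \<in> H p"
  shows "dual_connes \<alpha> \<in> H (p - 1)"
proof -
  have "\<kappa> (c \<sqinter> \<alpha>) \<in> Hl (d - (p - 1))"
    using \<kappa>_degree[OF cap_degree[OF c_degree assms]] by (simp add: algebra_simps)
  then have "inv (cap c) (\<kappa> (c \<sqinter> \<alpha>)) \<in> H (p - 1)"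
    using inv_cap_degree by (auto simp: bij_betw_def)
  then show ?thesis
    unfolding dual_connes_def by (rule coh.subspace_scale[OF coh.subspace_G])
qed

lemma eq_if_cap_fundamental_eq: "c \<sqinter> \<alpha> = c \<sqinter> \<beta> \<Longrightarrow> \<alpha> = \<beta>"
  by (rule injD[OF bij_is_inj[OF bij_cap_fundamental]])

lemma dual_connes_linear: "Vector_Spaces.linear scale scale dual_connes"
proof -
  interpret R: Vector_Spaces.linear scale scale' "cap c" by (rule cap_linear_right)
  interpret K: Vector_Spaces.linear scale' scale' \<kappa> by (rule \<kappa>_linear)
  show ?thesis
  proof unfold_locales
    show "dual_connes (\<alpha> + \<beta>) = dual_connes \<alpha> + dual_connes \<beta>" for \<alpha> \<beta>
      by (rule eq_if_cap_fundamental_eq)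
        (simp add: cap_dual_connes R.add K.add hom.scale_right_distrib)
    show "dual_connes (scale a \<alpha>) = scale a (dual_connes \<alpha>)" for a \<alpha>
      by (rule eq_if_cap_fundamental_eq)
        (simp add: cap_dual_connes R.scale K.scale mult.commute)
  qed
qed

lemma dual_connes_square: "dual_connes (dual_connes \<alpha>) = 0"
proof (rule eq_if_cap_fundamental_eq)
  interpret R: Vector_Spaces.linear scale scale' "cap c" by (rule cap_linear_right)
  interpret K: Vector_Spaces.linear scale' scale' \<kappa> by (rule \<kappa>_linear)
  show "c \<sqinter> dual_connes (dual_connes \<alpha>) = c \<sqinter> 0"
    by (simp add: cap_dual_connes K.scale \<kappa>_square R.zero)
qed

section \<open>Evaluation at the fundamental class\<close>

lemma connes_fundamental_class: "\<kappa> c = 0"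
proof -
  interpret R: Vector_Spaces.linear scale scale' "cap c" by (rule cap_linear_right)
  have "\<kappa> c \<in> Hl (d - (-1))" using \<kappa>_degree[OF c_degree] by simp
  moreover have "H (-1) = {0}" by (rule coh.H_negative) simp
  ultimately show ?thesis
    using duality[of "-1"] R.zero by (auto simp: bij_betw_def)
qed

lemma eq_if_contraction_fundamental_eq:
  assumes "\<alpha> \<in> H p" "\<beta> \<in> H p" "contraction \<alpha> c = contraction \<beta> c"
  shows "\<alpha> = \<beta>"
  using assms
  by (intro eq_if_cap_fundamental_eq)
    (simp add: contraction_homogeneous[OF _ c_degree])

text \<open>
  The sign of \<open>dual_connes\<close> is forced here: contracting \<open>c\<close> by classes of degrees \<open>p\<close> and \<open>p - 1\<close>
  differs from capping by the signs \<open>(-1)\<^bsup>dp\<^esup>\<close> and \<open>(-1)\<^bsup>d(p-1)\<^esup>\<close>, whose quotient is \<open>(-1)\<^sup>d\<close>.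
\<close>
lemma connes_contraction_fundamental:
  assumes "\<alpha> \<in> H p"
  shows "\<kappa> (contraction \<alpha> c) = contraction (dual_connes \<alpha>) c"
proof -
  interpret K: Vector_Spaces.linear scale' scale' \<kappa> by (rule \<kappa>_linear)
  have "((-1) powi (d * (p - 1)) * (-1) powi d :: 'k) = (-1) powi (d * p)"
    by (auto simp: power_int_minus_left)
  then show ?thesis
    by (simp add: contraction_homogeneous[OF assms c_degree] K.scale cap_dual_connes
        contraction_homogeneous[OF dual_connes_degree[OF assms] c_degree])
qed

lemma bracket_generated:
  assumes \<alpha>: "\<alpha> \<in> H p" and \<beta>: "\<beta> \<in> H q"
  shows "bracket \<alpha> \<beta> =
    dual_connes (\<alpha> \<squnion> \<beta>) - scale ((-1) powi p) (\<alpha> \<squnion> dual_connes \<beta>) - dual_connes \<alpha> \<squnion> \<beta>"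
proof (rule eq_if_contraction_fundamental_eq[where p = "p + q - 1"])
  interpret K: Vector_Spaces.linear scale' scale' \<kappa> by (rule \<kappa>_linear)
  note \<iota>\<iota> = contraction_cup[THEN fun_cong, unfolded o_apply]
  let ?\<epsilon> = "(-1) powi ((p - 1) * q) :: 'k"
  note \<Delta>\<alpha> = dual_connes_degree[OF \<alpha>] and \<Delta>\<beta> = dual_connes_degree[OF \<beta>]
  have deg: "dual_connes (\<alpha> \<squnion> \<beta>) \<in> H (p + q - 1)" "\<alpha> \<squnion> dual_connes \<beta> \<in> H (p + q - 1)"
    "dual_connes \<alpha> \<squnion> \<beta> \<in> H (p + q - 1)" "\<beta> \<squnion> dual_connes \<alpha> \<in> H (p + q - 1)"
    using dual_connes_degree[OF coh.cup_degree[OF \<alpha> \<beta>]] coh.cup_degree[OF \<alpha> \<Delta>\<beta>]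
      coh.cup_degree[OF \<Delta>\<alpha> \<beta>] coh.cup_degree[OF \<beta> \<Delta>\<alpha>]
    by (simp_all add: algebra_simps)
  have deg_scale: "scale a (\<alpha> \<squnion> dual_connes \<beta>) \<in> H (p + q - 1)" for a
    by (rule coh.subspace_scale[OF coh.subspace_G deg(2)])
  have deg_diff: "dual_connes (\<alpha> \<squnion> \<beta>) - scale a (\<alpha> \<squnion> dual_connes \<beta>) \<in> H (p + q - 1)" for a
    by (rule coh.subspace_diff[OF coh.subspace_G deg(1) deg_scale])
  show "bracket \<alpha> \<beta> \<in> H (p + q - 1)" by (rule coh.bracket_degree[OF \<alpha> \<beta>])
  show "dual_connes (\<alpha> \<squnion> \<beta>) - scale ((-1) powi p) (\<alpha> \<squnion> dual_connes \<beta>)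
      - dual_connes \<alpha> \<squnion> \<beta> \<in> H (p + q - 1)"
    by (rule coh.subspace_diff[OF coh.subspace_G deg_diff deg(3)])
  have "contraction (bracket \<alpha> \<beta>) c
      = lie_derivative p \<alpha> (contraction \<beta> c) - scale' ?\<epsilon> (contraction \<beta> (lie_derivative p \<alpha> c))"
    by (rule lie_contraction[OF \<alpha> \<beta>, symmetric])
  also have "lie_derivative p \<alpha> (contraction \<beta> c)
      = contraction (dual_connes (\<alpha> \<squnion> \<beta>)) c
        - scale' ((-1) powi p) (contraction (\<alpha> \<squnion> dual_connes \<beta>) c)"
    by (simp add: lie_derivative_def \<iota>\<iota>[OF \<alpha> \<beta>] \<iota>\<iota>[OF \<alpha> \<Delta>\<beta>]
        connes_contraction_fundamental[OF \<beta>]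
        connes_contraction_fundamental[OF coh.cup_degree[OF \<alpha> \<beta>]])
  also have "contraction \<beta> (lie_derivative p \<alpha> c) = contraction (\<beta> \<squnion> dual_connes \<alpha>) c"
    by (simp add: lie_derivative_def connes_fundamental_class contraction_zero_right
        connes_contraction_fundamental[OF \<alpha>] \<iota>\<iota>[OF \<beta> \<Delta>\<alpha>])
  also have "scale' ?\<epsilon> (contraction (\<beta> \<squnion> dual_connes \<alpha>) c) = contraction (dual_connes \<alpha> \<squnion> \<beta>) c"
    by (simp add: coh.cup_commute[OF \<Delta>\<alpha> \<beta>] contraction_scale_left[OF deg(4) c_degree])
  finally show "contraction (bracket \<alpha> \<beta>) c =
      contraction (dual_connes (\<alpha> \<squnion> \<beta>) - scale ((-1) powi p) (\<alpha> \<squnion> dual_connes \<beta>)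
        - dual_connes \<alpha> \<squnion> \<beta>) c"
    by (simp add: contraction_diff_left[OF deg_diff deg(3) c_degree]
        contraction_diff_left[OF deg(1) deg_scale c_degree]
        contraction_scale_left[OF deg(2) c_degree])
qed

lemma BV_generator_dual_connes: "BV_generator scale H cup one bracket dual_connes"
  by (intro BV_generator.intro BV_generator_axioms.intro coh.gerstenhaber_algebra_axioms
      dual_connes_linear dual_connes_degree dual_connes_square bracket_generated)

end

theorem mainTheorem1:
  fixes scale :: "'k::field \<Rightarrow> 'a::ab_group_add \<Rightarrow> 'a"
    and H :: "int \<Rightarrow> 'a set"
    and cup :: "'a \<Rightarrow> 'a \<Rightarrow> 'a"
    and one :: 'a
    and bracket :: "'a \<Rightarrow> 'a \<Rightarrow> 'a"
    and scale' :: "'k \<Rightarrow> 'b::ab_group_add \<Rightarrow> 'b"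
    and Hl :: "int \<Rightarrow> 'b set"
    and cap :: "'b \<Rightarrow> 'a \<Rightarrow> 'b"
    and \<kappa> :: "'b \<Rightarrow> 'b"
    and d :: int
    and c :: 'b
  assumes "calculus_with_duality scale H cup one bracket scale' Hl cap \<kappa> d c"
  shows "let D = inv (cap c);
             \<Delta> = (\<lambda>\<alpha>. scale ((-1) powi d) (D (\<kappa> (cap c \<alpha>))))
         in (\<forall>p. bij_betw D (Hl (d - p)) (H p)) \<and>
            BV_algebra scale H cup one bracket \<and>
            BV_generator scale H cup one bracket \<Delta>"
proof -
  interpret calculus_with_duality scale H cup one bracket scale' Hl cap \<kappa> d c by (rule assms)
  have "BV_generator scale H cup one bracket
      (\<lambda>\<alpha>. scale ((-1) powi d) (inv (cap c) (\<kappa> (cap c \<alpha>))))"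
    using BV_generator_dual_connes unfolding dual_connes_def[abs_def] .
  then show ?thesis
    unfolding Let_def BV_algebra_def by (intro conjI allI exI inv_cap_degree)
qed

end
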